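(* Let $\omega_0\in[0,\pi]$ and let $\phi_{1,\omega_0},\phi_{2,\omega_0}$ be the Hermite exponential spline generators defined in the context. Then for all $x\in\mathbb{R}$, $$x^m=\sum_{n\in\mathbb{Z}}\big(n^m\,\phi_{1,\omega_0}(x-n)+m\,n^{m-1}\,\phi_{2,\omega_0}(x-n)\big),\qquad m=0,1,$$ (where for $m=0$ the second term is $0$), and $$e^{\pm i\omega_0x}=\sum_{n\in\mathbb{Z}}\big(e^{\pm i\omega_0n}\,\phi_{1,\omega_0}(x-n)\pm i\omega_0\,e^{\pm i\omega_0n}\,\phi_{2,\omega_0}(x-n)\big).$$
   Context: For $\omega_0\in(0,\pi]$ put $$s(\omega_0)=2\sin(\omega_0/2)-\omega_0\cos(\omega_0/2),\qquad t(\omega_0)=2\sin(\omega_0/2)+\omega_0\cos(\omega_0/2),$$ $$u(\omega_0)=\omega_0\sin(\omega_0)-2(1-\cos(\omega_0)),\qquad v(\omega_0)=2\sin(\omega_0)+\omega_0(1-\cos(\omega_0)),$$ and let $\chi_{[0,1]}$ be the indicator function of $[0,1]$. Define $$g_{1,\omega_0}(x)=\Big(1-\tfrac{\sin(\omega_0/2)}{s(\omega_0)}+\tfrac{\omega_0\cos(\omega_0/2)}{s(\omega_0)}x+\tfrac{\sin(\omega_0/2-\omega_0x)}{s(\omega_0)}\Big)\chi_{[0,1]}(x),$$ $$g_{2,\omega_0}(x)=\Big(\tfrac{\sin(\omega_0)-\omega_0\cos(\omega_0)}{\omega_0u(\omega_0)}+\tfrac{\sin(\omega_0/2)}{s(\omega_0)}x-\tfrac{\omega_0^2\cos(\omega_0/2)\cos(\omega_0(1-x))+\sin(\omega_0/2)\big(\sin(\omega_0x)u(\omega_0)-\cos(\omega_0x)v(\omega_0)\big)}{2\omega_0\sin(\omega_0/2)s(\omega_0)t(\omega_0)}\Big)\chi_{[0,1]}(x).$$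 The generators are $\phi_{1,\omega_0}(x)=g_{1,\omega_0}(x)$ for $x\ge0$, $\phi_{1,\omega_0}(x)=g_{1,\omega_0}(-x)$ for $x<0$; and $\phi_{2,\omega_0}(x)=g_{2,\omega_0}(x)$ for $x\ge0$, $\phi_{2,\omega_0}(x)=-g_{2,\omega_0}(-x)$ for $x<0$. On $[0,1]$, $\phi_{1,\omega_0}$ and $\phi_{2,\omega_0}$ are the elements of $\mathrm{span}\{1,x,e^{i\omega_0x},e^{-i\omega_0x}\}$ with $\phi_1(0)=1,\phi_1'(0)=\phi_1(1)=\phi_1'(1)=0$ and $\phi_2'(0)=1,\phi_2(0)=\phi_2(1)=\phi_2'(1)=0$, respectively. For $\omega_0=0$ the functions are understood as the limits as $\omega_0\to0$: $g_{1,0}(x)=(2x+1)(x-1)^2\chi_{[0,1]}(x)$ and $g_{2,0}(x)=x(x-1)^2\chi_{[0,1]}(x)$, with the same symmetric and antisymmetric extensions. *)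

theory Defs
  imports "HOL-Analysis.Analysis"
begin

definition s_aux :: "real \<Rightarrow> real" where
  "s_aux \<omega> = 2 * sin (\<omega> / 2) - \<omega> * cos (\<omega> / 2)"

definition t_aux :: "real \<Rightarrow> real" where
  "t_aux \<omega> = 2 * sin (\<omega> / 2) + \<omega> * cos (\<omega> / 2)"

definition u_aux :: "real \<Rightarrow> real" where
  "u_aux \<omega> = \<omega> * sin \<omega> - 2 * (1 - cos \<omega>)"

definition v_aux :: "real \<Rightarrow> real" where
  "v_aux \<omega> = 2 * sin \<omega> + \<omega> * (1 - cos \<omega>)"

text \<open>At \<open>\<omega> = 0\<close> the closed formulas below degenerate (their denominators vanish); there the
  generators are the limits as \<open>\<omega>\<close> tends to \<open>0\<close>, i.e. the classical cubic Hermite polynomials.\<close>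

definition g1 :: "real \<Rightarrow> real \<Rightarrow> real" where
  "g1 \<omega> x =
    (if \<omega> = 0 then (2 * x + 1) * (x - 1)^2
     else 1 - sin (\<omega> / 2) / s_aux \<omega>
          + (\<omega> * cos (\<omega> / 2) / s_aux \<omega>) * x
          + sin (\<omega> / 2 - \<omega> * x) / s_aux \<omega>) * indicat_real {0..1} x"

definition g2 :: "real \<Rightarrow> real \<Rightarrow> real" where
  "g2 \<omega> x =
    (if \<omega> = 0 then x * (x - 1)^2
     else (sin \<omega> - \<omega> * cos \<omega>) / (\<omega> * u_aux \<omega>)
          + (sin (\<omega> / 2) / s_aux \<omega>) * x
          - (\<omega>^2 * cos (\<omega> / 2) * cos (\<omega> * (1 - x))
             + sin (\<omega> / 2) * (sin (\<omega> * x) * u_aux \<omega> - cos (\<omega> * x) * v_aux \<omega>))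
            / (2 * \<omega> * sin (\<omega> / 2) * s_aux \<omega> * t_aux \<omega>)) * indicat_real {0..1} x"

definition \<phi>1 :: "real \<Rightarrow> real \<Rightarrow> real" where
  "\<phi>1 \<omega> x = (if x \<ge> 0 then g1 \<omega> x else g1 \<omega> (- x))"

definition \<phi>2 :: "real \<Rightarrow> real \<Rightarrow> real" where
  "\<phi>2 \<omega> x = (if x \<ge> 0 then g2 \<omega> x else - g2 \<omega> (- x))"

end

theory Submission
  imports Defs
begin

text \<open>
  Fix \<open>x\<close> and write \<open>x = k + r\<close> with \<open>k = \<lfloor>x\<rfloor>\<close>. The generators are supported in \<open>[-1,1]\<close> and vanish at
  \<open>\<plusminus>1\<close>, so a series \<open>\<Sum>n. a n \<phi>1(x - n) + b n \<phi>2(x - n)\<close> has only the terms \<open>n = k\<close> and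
  \<open>n = k + 1\<close>; it equals
  \<open>a k g1(r) + a (k+1) g1(1 - r) + b k g2(r) - b (k+1) g2(1 - r)\<close> (lemma \<open>has_sum_generators\<close>).
  Everything thus reduces to reproducing \<open>1\<close>, \<open>x\<close> and \<open>exp (\<plusminus>\<i>\<omega>x)\<close> on one cell.

  There the reflection \<open>r \<mapsto> 1 - r\<close> is what matters, so the generators are rewritten in the centred
  variable \<open>y = r - 1/2\<close>. With \<open>S = sin (\<omega>/2)\<close>, \<open>C = cos (\<omega>/2)\<close> and \<open>s = 2S - \<omega>C\<close>, the closed
  formulas collapse to
  \<open>g1 = 1/2 + (\<omega>Cy - sin (\<omega>y)) / s\<close> and
  \<open>g2 = (cos (\<omega>y) - C) / (2\<omega>S) + (2Sy - sin (\<omega>y)) / (2s)\<close>.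
  Sums and differences of the values at \<open>r\<close> and \<open>1 - r\<close> now isolate the even and odd parts in \<open>y\<close>.
  The constant is reproduced because \<open>g1 - 1/2\<close> is odd, and the identity function because the sines
  cancel. For the exponential, factoring out its value at the midpoint of the cell leaves the
  claim \<open>exp (\<i>\<omega>y)\<close>, whose real part only sees the even part of \<open>g2\<close> and whose imaginary part only
  sees the odd parts. The exponential with the opposite sign follows by conjugation. At \<open>\<omega> = 0\<close> the
  exponential is the constant, and the identities for \<open>1\<close> and \<open>x\<close> are polynomial ones.
\<close>

section \<open>The generators in the centred variable\<close>

text \<open>This is \<open>h < tan h\<close> for \<open>h = \<omega>/2\<close>, extended to \<open>h = \<pi>/2\<close>: as a function of \<open>h\<close>, the quantity
  vanishes at \<open>0\<close> and has the derivative \<open>2 h sin h\<close>.\<close>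

lemma s_aux_pos:
  assumes "0 < \<omega>" "\<omega> \<le> pi"
  shows "s_aux \<omega> > 0"
proof -
  define f where "f h = 2 * sin h - 2 * h * cos h" for h :: real
  have "f 0 < f (\<omega> / 2)"
  proof (rule DERIV_pos_imp_increasing_open[where f = f])
    fix h :: real assume h: "0 < h" "h < \<omega> / 2"
    have "(f has_real_derivative 2 * h * sin h) (at h)"
      unfolding f_def by (auto intro!: derivative_eq_intros)
    moreover have "2 * h * sin h > 0"
      using h assms by (intro mult_pos_pos sin_gt_zero) auto
    ultimately show "\<exists>y. DERIV f h :> y \<and> 0 < y"
      by blast
  qed (use assms in \<open>auto simp: f_def intro!: continuous_intros\<close>)
  thus ?thesis
    by (simp add: f_def s_aux_def)
qed

lemma sin_half_pos:
  assumes "0 < \<omega>" "\<omega> \<le> pi"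
  shows "sin (\<omega> / 2) > 0"
  using assms by (intro sin_gt_zero) auto

lemma t_aux_pos:
  assumes "0 < \<omega>" "\<omega> \<le> pi"
  shows "t_aux \<omega> > 0"
proof -
  have "cos (\<omega> / 2) \<ge> 0"
    using assms by (intro cos_ge_zero) auto
  thus ?thesis
    using sin_half_pos[OF assms] assms by (simp add: t_aux_def add_pos_nonneg)
qed

lemma g1_centred:
  assumes "0 < \<omega>" "\<omega> \<le> pi" "0 \<le> x" "x \<le> 1"
  shows "g1 \<omega> x = 1 / 2 + (\<omega> * cos (\<omega> / 2) * (x - 1 / 2) - sin (\<omega> * (x - 1 / 2))) / s_aux \<omega>"
proof -
  have *: "sin (\<omega> / 2 - \<omega> * x) = - sin (\<omega> * (x - 1 / 2))"
    by (simp add: algebra_simps flip: sin_minus)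
  have s: "s_aux \<omega> \<noteq> 0"
    using s_aux_pos[OF assms(1,2)] by simp
  have sin: "sin (\<omega> / 2) = (s_aux \<omega> + \<omega> * cos (\<omega> / 2)) / 2"
    by (simp add: s_aux_def)
  have "g1 \<omega> x = 1 - sin (\<omega> / 2) / s_aux \<omega> + \<omega> * cos (\<omega> / 2) / s_aux \<omega> * x
                 - sin (\<omega> * (x - 1 / 2)) / s_aux \<omega>"
    using assms by (simp add: g1_def *)
  also have "\<dots> = 1 / 2 + (\<omega> * cos (\<omega> / 2) * (x - 1 / 2) - sin (\<omega> * (x - 1 / 2))) / s_aux \<omega>"
    unfolding sin using s by (simp add: field_simps)
  finally show ?thesis .
qed

text \<open>Half-angle formulas give \<open>u = -2Ss\<close> and \<open>v = 2S(2C + \<omega>S)\<close>. Expanding the large numerator around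
  the midpoint then turns it into \<open>-st cos (\<omega>y) + \<omega>St sin (\<omega>y)\<close>, so that \<open>t\<close> cancels against the
  denominator.\<close>

lemma g2_centred:
  assumes "0 < \<omega>" "\<omega> \<le> pi" "0 \<le> x" "x \<le> 1"
  shows "g2 \<omega> x = (cos (\<omega> * (x - 1 / 2)) - cos (\<omega> / 2)) / (2 * \<omega> * sin (\<omega> / 2))
           + (2 * sin (\<omega> / 2) * (x - 1 / 2) - sin (\<omega> * (x - 1 / 2))) / (2 * s_aux \<omega>)"
proof -
  define S C where "S = sin (\<omega> / 2)" and "C = cos (\<omega> / 2)"
  define P Q where "P = cos (\<omega> * (x - 1 / 2))" and "Q = sin (\<omega> * (x - 1 / 2))"
  define s t where "s = s_aux \<omega>" and "t = t_aux \<omega>"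
  have s_eq: "s = 2 * S - \<omega> * C" and t_eq: "t = 2 * S + \<omega> * C"
    by (simp_all add: s_def t_def s_aux_def t_aux_def S_def C_def)
  have nz: "s \<noteq> 0" "t \<noteq> 0" "S \<noteq> 0" "\<omega> \<noteq> 0"
    using s_aux_pos[OF assms(1,2)] t_aux_pos[OF assms(1,2)] sin_half_pos[OF assms(1,2)] assms(1)
    by (auto simp: s_def t_def S_def)
  have pyth: "C\<^sup>2 = 1 - S\<^sup>2"
    by (simp add: C_def S_def cos_squared_eq)
  have sin: "sin \<omega> = 2 * S * C" and cos: "cos \<omega> = 1 - 2 * S\<^sup>2"
    using sin_double[of "\<omega> / 2"] cos_double_sin[of "\<omega> / 2"] by (simp_all add: S_def C_def)
  have u: "u_aux \<omega> = - 2 * S * s"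
    unfolding u_aux_def sin cos s_eq by algebra
  have v: "v_aux \<omega> = 2 * S * (2 * C + \<omega> * S)"
    unfolding v_aux_def sin cos by algebra
  have "cos (\<omega> * (1 - x)) = cos (\<omega> / 2 - \<omega> * (x - 1 / 2))"
    by (simp add: algebra_simps)
  hence c1: "cos (\<omega> * (1 - x)) = C * P + S * Q"
    by (simp only: cos_diff C_def P_def S_def Q_def)
  have split: "\<omega> * x = \<omega> / 2 + \<omega> * (x - 1 / 2)"
    by (simp add: algebra_simps)
  have c2: "cos (\<omega> * x) = C * P - S * Q"
    by (subst split) (simp only: cos_add C_def P_def S_def Q_def)
  have s2: "sin (\<omega> * x) = S * P + C * Q"
    by (subst split) (simp only: sin_add C_def P_def S_def Q_def)
  have num: "\<omega>\<^sup>2 * C * cos (\<omega> * (1 - x)) + S * (sin (\<omega> * x) * u_aux \<omega> - cos (\<omega> * x) * v_aux \<omega>)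
          = - (s * t * P) + \<omega> * S * t * Q"
    unfolding u v c1 c2 s2 s_eq t_eq using pyth by algebra
  have "(\<omega>\<^sup>2 * C * cos (\<omega> * (1 - x)) + S * (sin (\<omega> * x) * u_aux \<omega> - cos (\<omega> * x) * v_aux \<omega>))
          / (2 * \<omega> * S * s * t) = - P / (2 * \<omega> * S) + Q / (2 * s)"
    unfolding num using nz by (simp add: field_simps)
  moreover have "(sin \<omega> - \<omega> * cos \<omega>) / (\<omega> * u_aux \<omega>) = - C / (2 * \<omega> * S) - S / (2 * s)"
  proof -
    have "sin \<omega> - \<omega> * cos \<omega> = C * s + \<omega> * S\<^sup>2"
      unfolding sin cos s_eq using pyth by algebra
    thus ?thesis
      unfolding u using nz by (simp add: field_simps power2_eq_square)
  qed
  ultimately have "g2 \<omega> x = - C / (2 * \<omega> * S) - S / (2 * s) + S / s * x - (- P / (2 * \<omega> * S) + Q / (2 * s))"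
    using assms nz(4) by (simp add: g2_def S_def C_def s_def t_def)
  also have "\<dots> = (P - C) / (2 * \<omega> * S) + (2 * S * (x - 1 / 2) - Q) / (2 * s)"
    using nz by (simp add: field_simps)
  finally show ?thesis
    by (simp only: P_def Q_def S_def C_def s_def)
qed

section \<open>Reproduction on one cell\<close>

lemma sin_cos_reflect_midpoint:
  fixes \<omega> r :: real
  shows "sin (\<omega> * (1 - r - 1 / 2)) = - sin (\<omega> * (r - 1 / 2))"
    and "cos (\<omega> * (1 - r - 1 / 2)) = cos (\<omega> * (r - 1 / 2))"
proof -
  have "\<omega> * (1 - r - 1 / 2) = - (\<omega> * (r - 1 / 2))"
    by (simp add: algebra_simps)
  thus "sin (\<omega> * (1 - r - 1 / 2)) = - sin (\<omega> * (r - 1 / 2))"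
    and "cos (\<omega> * (1 - r - 1 / 2)) = cos (\<omega> * (r - 1 / 2))"
    by (simp_all only: sin_minus cos_minus)
qed

context
  fixes \<omega> r :: real
  assumes \<omega>: "0 \<le> \<omega>" "\<omega> \<le> pi" and r: "0 \<le> r" "r \<le> 1"
begin

lemma g1_add_reflect: "g1 \<omega> r + g1 \<omega> (1 - r) = 1"
proof (cases "\<omega> = 0")
  case True
  thus ?thesis using r by (simp add: g1_def power2_eq_square algebra_simps)
next
  case False
  hence pos: "0 < \<omega>" using \<omega> by simp
  have "0 \<le> 1 - r" "1 - r \<le> 1"
    using r by auto
  note g1 = g1_centred[OF pos \<omega>(2) r] g1_centred[OF pos \<omega>(2) this]
  show ?thesis
    using s_aux_pos[OF pos \<omega>(2)]
    unfolding g1 sin_cos_reflect_midpoint by (simp add: field_simps)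
qed

lemma g1_diff_reflect:
  assumes "0 < \<omega>"
  shows "g1 \<omega> (1 - r) - g1 \<omega> r
           = 2 * (sin (\<omega> * (r - 1 / 2)) - \<omega> * cos (\<omega> / 2) * (r - 1 / 2)) / s_aux \<omega>"
proof -
  have "g1 \<omega> (1 - r) - g1 \<omega> r = 1 - 2 * g1 \<omega> r"
    using g1_add_reflect by simp
  also have "\<dots> = 2 * (sin (\<omega> * (r - 1 / 2)) - \<omega> * cos (\<omega> / 2) * (r - 1 / 2)) / s_aux \<omega>"
    using s_aux_pos[OF assms \<omega>(2)] unfolding g1_centred[OF assms \<omega>(2) r] by (simp add: field_simps)
  finally show ?thesis .
qed

lemma g2_diff_reflect:
  assumes "0 < \<omega>"
  shows "g2 \<omega> r - g2 \<omega> (1 - r)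
           = (2 * sin (\<omega> / 2) * (r - 1 / 2) - sin (\<omega> * (r - 1 / 2))) / s_aux \<omega>"
proof -
  have "0 \<le> 1 - r" "1 - r \<le> 1"
    using r by auto
  note g2 = g2_centred[OF assms \<omega>(2) r] g2_centred[OF assms \<omega>(2) this]
  show ?thesis
    using s_aux_pos[OF assms \<omega>(2)]
    unfolding g2 sin_cos_reflect_midpoint by (simp add: field_simps)
qed

lemma g2_add_reflect:
  assumes "0 < \<omega>"
  shows "g2 \<omega> r + g2 \<omega> (1 - r) = (cos (\<omega> * (r - 1 / 2)) - cos (\<omega> / 2)) / (\<omega> * sin (\<omega> / 2))"
proof -
  have "0 \<le> 1 - r" "1 - r \<le> 1"
    using r by auto
  note g2 = g2_centred[OF assms \<omega>(2) r] g2_centred[OF assms \<omega>(2) this]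
  show ?thesis
    using s_aux_pos[OF assms \<omega>(2)] sin_half_pos[OF assms \<omega>(2)] assms
    unfolding g2 sin_cos_reflect_midpoint by (simp add: field_simps)
qed

lemma cell_reproduces_id: "g1 \<omega> (1 - r) + g2 \<omega> r - g2 \<omega> (1 - r) = r"
proof (cases "\<omega> = 0")
  case True
  thus ?thesis using r by (simp add: g1_def g2_def power2_eq_square algebra_simps)
next
  case False
  hence pos: "0 < \<omega>" using \<omega> by simp
  have "2 * (g1 \<omega> (1 - r) + g2 \<omega> r - g2 \<omega> (1 - r))
          = 1 + (g1 \<omega> (1 - r) - g1 \<omega> r) + 2 * (g2 \<omega> r - g2 \<omega> (1 - r))"
    using g1_add_reflect by simp
  also have "\<dots> = 1 + 2 * (r - 1 / 2) * ((2 * sin (\<omega> / 2) - \<omega> * cos (\<omega> / 2)) / s_aux \<omega>)"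
    unfolding g1_diff_reflect[OF pos] g2_diff_reflect[OF pos]
    using s_aux_pos[OF pos \<omega>(2)] by (simp add: field_simps)
  also have "\<dots> = 2 * r"
    using s_aux_pos[OF pos \<omega>(2)] by (simp flip: s_aux_def)
  finally show ?thesis by simp
qed

text \<open>The real and imaginary parts of the exponential identity, once the phase at the midpoint of the
  cell is divided out.\<close>

lemma cell_reproduces_cos:
  "cos (\<omega> / 2) + \<omega> * sin (\<omega> / 2) * (g2 \<omega> r + g2 \<omega> (1 - r)) = cos (\<omega> * (r - 1 / 2))"
proof (cases "\<omega> = 0")
  case False
  hence pos: "0 < \<omega>" using \<omega> by simp
  show ?thesis
    unfolding g2_add_reflect[OF pos] using pos sin_half_pos[OF pos \<omega>(2)] by simp
qed simp

lemma cell_reproduces_sin: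
  "sin (\<omega> / 2) * (g1 \<omega> (1 - r) - g1 \<omega> r) + \<omega> * cos (\<omega> / 2) * (g2 \<omega> r - g2 \<omega> (1 - r))
     = sin (\<omega> * (r - 1 / 2))"
proof (cases "\<omega> = 0")
  case False
  hence pos: "0 < \<omega>" using \<omega> by simp
  have "sin (\<omega> / 2) * (g1 \<omega> (1 - r) - g1 \<omega> r) + \<omega> * cos (\<omega> / 2) * (g2 \<omega> r - g2 \<omega> (1 - r))
          = sin (\<omega> * (r - 1 / 2)) * ((2 * sin (\<omega> / 2) - \<omega> * cos (\<omega> / 2)) / s_aux \<omega>)"
    unfolding g1_diff_reflect[OF pos] g2_diff_reflect[OF pos]
    using s_aux_pos[OF pos \<omega>(2)] by (simp add: field_simps)
  also have "\<dots> = sin (\<omega> * (r - 1 / 2))"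
    using s_aux_pos[OF pos \<omega>(2)] by (simp flip: s_aux_def)
  finally show ?thesis .
qed simp

lemma cell_reproduces_cis:
  "cis (\<omega> * k) * of_real (g1 \<omega> r) + cis (\<omega> * (k + 1)) * of_real (g1 \<omega> (1 - r))
   + \<i> * of_real \<omega> * cis (\<omega> * k) * of_real (g2 \<omega> r)
   - \<i> * of_real \<omega> * cis (\<omega> * (k + 1)) * of_real (g2 \<omega> (1 - r)) = cis (\<omega> * (k + r))"
proof -
  have centred: "cis (- (\<omega> / 2)) * of_real (g1 \<omega> r) + cis (\<omega> / 2) * of_real (g1 \<omega> (1 - r))
        + \<i> * of_real \<omega> * (cis (- (\<omega> / 2)) * of_real (g2 \<omega> r) - cis (\<omega> / 2) * of_real (g2 \<omega> (1 - r)))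
        = cis (\<omega> * (r - 1 / 2))" (is "?L = _")
  proof (rule complex_eqI)
    have "Re ?L = cos (\<omega> / 2) * (g1 \<omega> r + g1 \<omega> (1 - r))
                    + \<omega> * sin (\<omega> / 2) * (g2 \<omega> r + g2 \<omega> (1 - r))"
      by (simp add: algebra_simps)
    thus "Re ?L = Re (cis (\<omega> * (r - 1 / 2)))"
      by (simp add: g1_add_reflect cell_reproduces_cos)
    have "Im ?L = sin (\<omega> / 2) * (g1 \<omega> (1 - r) - g1 \<omega> r)
                    + \<omega> * cos (\<omega> / 2) * (g2 \<omega> r - g2 \<omega> (1 - r))"
      by (simp add: algebra_simps)
    thus "Im ?L = Im (cis (\<omega> * (r - 1 / 2)))"
      by (simp add: cell_reproduces_sin)
  qed
  have midpoint:
    "cis (\<omega> * k) = cis (\<omega> * (k + 1 / 2)) * cis (- (\<omega> / 2))"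
    "cis (\<omega> * (k + 1)) = cis (\<omega> * (k + 1 / 2)) * cis (\<omega> / 2)"
    "cis (\<omega> * (k + r)) = cis (\<omega> * (k + 1 / 2)) * cis (\<omega> * (r - 1 / 2))"
    by (simp_all add: cis_mult algebra_simps)
  show ?thesis
    unfolding midpoint centred[symmetric] by (simp add: algebra_simps)
qed

end

section \<open>Reduction of the series to one cell\<close>

lemma generators_outside:
  assumes "x < 0 \<or> 1 < x"
  shows "g1 \<omega> x = 0" "g2 \<omega> x = 0"
  using assms by (auto simp: g1_def g2_def indicator_def)

lemma generators_at_1:
  assumes "0 \<le> \<omega>" "\<omega> \<le> pi"
  shows "g1 \<omega> 1 = 0" "g2 \<omega> 1 = 0"
proof -
  have "g1 \<omega> 1 = 0 \<and> g2 \<omega> 1 = 0"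
  proof (cases "\<omega> = 0")
    case True
    thus ?thesis by (simp add: g1_def g2_def)
  next
    case False
    hence pos: "0 < \<omega>" using assms by simp
    have "2 * sin (\<omega> / 2) = s_aux \<omega> + \<omega> * cos (\<omega> / 2)"
      by (simp add: s_aux_def)
    thus ?thesis
      using s_aux_pos[OF pos assms(2)] by (simp add: g1_centred g2_centred pos assms field_simps)
  qed
  thus "g1 \<omega> 1 = 0" "g2 \<omega> 1 = 0" by simp_all
qed

text \<open>When \<open>r = 0\<close>, the term \<open>n = k - 1\<close> also meets the closed supports; it drops out because both
  generators vanish at \<open>1\<close>.\<close>

lemma has_sum_generators:
  fixes a b :: "int \<Rightarrow> 'a :: real_normed_algebra_1" and x \<omega> :: real
  assumes "0 \<le> \<omega>" "\<omega> \<le> pi"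
  defines "k \<equiv> \<lfloor>x\<rfloor>" and "r \<equiv> frac x"
  shows "((\<lambda>n. a n * of_real (\<phi>1 \<omega> (x - of_int n)) + b n * of_real (\<phi>2 \<omega> (x - of_int n))) has_sum
           a k * of_real (g1 \<omega> r) + a (k + 1) * of_real (g1 \<omega> (1 - r))
           + b k * of_real (g2 \<omega> r) - b (k + 1) * of_real (g2 \<omega> (1 - r))) UNIV"
proof (rule has_sum_finite_neutralI[where B = "{k, k + 1}"])
  have r: "0 \<le> r" "r < 1"
    by (simp_all add: r_def frac_lt_1)
  have x: "x = of_int k + r"
    by (simp add: k_def r_def frac_def)
  fix n :: int assume "n \<in> UNIV - {k, k + 1}"
  hence "n < k \<or> k + 1 < n" by auto
  hence "\<phi>1 \<omega> (x - of_int n) = 0 \<and> \<phi>2 \<omega> (x - of_int n) = 0"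
  proof
    assume "n < k"
    hence "1 \<le> x - of_int n" using x r by linarith
    thus ?thesis
      using generators_outside generators_at_1[OF assms(1,2)]
      by (cases "x - of_int n = 1") (auto simp: \<phi>1_def \<phi>2_def)
  next
    assume "k + 1 < n"
    hence "x - of_int n < - 1" using x r by linarith
    thus ?thesis by (auto simp: \<phi>1_def \<phi>2_def generators_outside)
  qed
  thus "a n * of_real (\<phi>1 \<omega> (x - of_int n)) + b n * of_real (\<phi>2 \<omega> (x - of_int n)) = 0"
    by simp
next
  have r: "0 \<le> r" "r < 1"
    by (simp_all add: r_def frac_lt_1)
  have x: "x - of_int k = r" "x - of_int (k + 1) = r - 1"
    by (simp_all add: k_def r_def frac_def)
  have "\<phi>1 \<omega> r = g1 \<omega> r" "\<phi>2 \<omega> r = g2 \<omega> r"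
       "\<phi>1 \<omega> (r - 1) = g1 \<omega> (1 - r)" "\<phi>2 \<omega> (r - 1) = - g2 \<omega> (1 - r)"
    using r by (simp_all add: \<phi>1_def \<phi>2_def)
  thus "a k * of_real (g1 \<omega> r) + a (k + 1) * of_real (g1 \<omega> (1 - r))
          + b k * of_real (g2 \<omega> r) - b (k + 1) * of_real (g2 \<omega> (1 - r))
        = (\<Sum>n\<in>{k, k + 1}. a n * of_real (\<phi>1 \<omega> (x - of_int n)) + b n * of_real (\<phi>2 \<omega> (x - of_int n)))"
    by (simp add: x del: of_int_add)
qed auto

theorem mainTheorem2:
  fixes \<omega> :: real
  assumes "0 \<le> \<omega>" and "\<omega> \<le> pi"
  shows "\<forall>x::real.
    (\<forall>m\<in>{0, 1::nat}.
      ((\<lambda>n::int. real_of_int n ^ m * \<phi>1 \<omega> (x - real_of_int n)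
                  + real m * real_of_int n ^ (m - 1) * \<phi>2 \<omega> (x - real_of_int n))
        has_sum x ^ m) UNIV)
    \<and> ((\<lambda>n::int. exp (\<i> * complex_of_real (\<omega> * real_of_int n))
                    * complex_of_real (\<phi>1 \<omega> (x - real_of_int n))
                + \<i> * complex_of_real \<omega> * exp (\<i> * complex_of_real (\<omega> * real_of_int n))
                    * complex_of_real (\<phi>2 \<omega> (x - real_of_int n)))
        has_sum exp (\<i> * complex_of_real (\<omega> * x))) UNIV
    \<and> ((\<lambda>n::int. exp (- \<i> * complex_of_real (\<omega> * real_of_int n))
                    * complex_of_real (\<phi>1 \<omega> (x - real_of_int n))
                - \<i> * complex_of_real \<omega> * exp (- \<i> * complex_of_real (\<omega> * real_of_int n))
                    * complex_of_real (\<phi>2 \<omega> (x - real_of_int n)))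
        has_sum exp (- \<i> * complex_of_real (\<omega> * x))) UNIV"
proof (intro allI conjI ballI)
  fix x :: real
  define k r where "k = \<lfloor>x\<rfloor>" and "r = frac x"
  have r: "0 \<le> r" "r \<le> 1"
    by (simp_all add: r_def frac_lt_1 less_imp_le)
  have x: "x = of_int k + r"
    by (simp add: k_def r_def frac_def)
  note unity = g1_add_reflect[OF assms r] and id = cell_reproduces_id[OF assms r]
    and cis = cell_reproduces_cis[OF assms r]
  note sum = has_sum_generators[OF assms, where x = x, folded k_def r_def]
  {
    fix m :: nat assume m: "m \<in> {0, 1}"
    define a b :: "int \<Rightarrow> real" where "a n = of_int n ^ m" and "b n = real m * of_int n ^ (m - 1)" for n
    have "a k * g1 \<omega> r + a (k + 1) * g1 \<omega> (1 - r) + b k * g2 \<omega> r - b (k + 1) * g2 \<omega> (1 - r) = x ^ m"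
    proof (cases "m = 0")
      case True
      thus ?thesis using unity by (simp add: a_def b_def)
    next
      case False
      hence "m = 1" using m by simp
      hence "a k * g1 \<omega> r + a (k + 1) * g1 \<omega> (1 - r) + b k * g2 \<omega> r - b (k + 1) * g2 \<omega> (1 - r)
              = of_int k * (g1 \<omega> r + g1 \<omega> (1 - r)) + (g1 \<omega> (1 - r) + g2 \<omega> r - g2 \<omega> (1 - r))"
        by (simp add: a_def b_def algebra_simps)
      thus ?thesis using unity id x \<open>m = 1\<close> by simp
    qed
    thus "((\<lambda>n::int. real_of_int n ^ m * \<phi>1 \<omega> (x - real_of_int n)
                  + real m * real_of_int n ^ (m - 1) * \<phi>2 \<omega> (x - real_of_int n)) has_sum x ^ m) UNIV"
      using sum[of a b] by (simp add: a_def b_def)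
  }
  have "((\<lambda>n. cis (\<omega> * of_int n) * of_real (\<phi>1 \<omega> (x - of_int n))
            + \<i> * of_real \<omega> * cis (\<omega> * of_int n) * of_real (\<phi>2 \<omega> (x - of_int n)))
          has_sum cis (\<omega> * x)) UNIV"
    using sum[of "\<lambda>n. cis (\<omega> * of_int n)" "\<lambda>n. \<i> * of_real \<omega> * cis (\<omega> * of_int n)"]
      cis[of "of_int k"] by (simp flip: x)
  thus pos: "((\<lambda>n::int. exp (\<i> * complex_of_real (\<omega> * real_of_int n))
                    * complex_of_real (\<phi>1 \<omega> (x - real_of_int n))
                + \<i> * complex_of_real \<omega> * exp (\<i> * complex_of_real (\<omega> * real_of_int n))
                    * complex_of_real (\<phi>2 \<omega> (x - real_of_int n)))
        has_sum exp (\<i> * complex_of_real (\<omega> * x))) UNIV"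
    by (simp only: cis_conv_exp)
  have "cnj (exp (\<i> * complex_of_real y)) = exp (- \<i> * complex_of_real y)" for y
    by (simp add: exp_cnj)
  thus "((\<lambda>n::int. exp (- \<i> * complex_of_real (\<omega> * real_of_int n))
                    * complex_of_real (\<phi>1 \<omega> (x - real_of_int n))
                - \<i> * complex_of_real \<omega> * exp (- \<i> * complex_of_real (\<omega> * real_of_int n))
                    * complex_of_real (\<phi>2 \<omega> (x - real_of_int n)))
        has_sum exp (- \<i> * complex_of_real (\<omega> * x))) UNIV"
    using has_sum_cnj_iff[THEN iffD2, OF pos]
    by (simp only: complex_cnj_add complex_cnj_mult complex_cnj_complex_of_real complex_cnj_i
          mult_minus_left add_uminus_conv_diff)
qed

end
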